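(* Let $(S,\mathcal T,I)$ be a closed connected weighted triangulated surface, with Euclidean or hyperbolic background geometry, with vertex set $V=[N]$, edge set $E$ and face set $F$, such that $I_{ij}\in(-1,1]$ for every edge $ij\in E$. Let $A,B\subset[N]$ with $[N]=A\sqcup B$ and $A\neq\varnothing$, and, in the case of Euclidean background geometry, also $B\neq\varnothing$. Suppose that for every face $ijk\in F$ one has $$I_{jk}+I_{ik}I_{ij}\ge 0,\qquad I_{ik}+I_{jk}I_{ij}\ge 0,\qquad I_{ij}+I_{jk}I_{ik}\ge 0 .$$ Then for any circle packing metrics $R$ and $r$ for $(S,\mathcal T,I)$ such that $R(i)\ge r(i)$ for all $i\in B$ and $K_R(i)\ge K_r(i)$ for all $i\in A$, one has $R(i)\ge r(i)$ for all $i\in V$.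
   Context: Weighted triangulated surface: $S$ is a surface with a finite simplicial triangulation $\mathcal T=(V,E,F)$ (vertices, edges, faces), where $V$ is identified with $[N]=\{1,\dots,N\}$, $E\subset\binom{[N]}{2}$, $F\subset\binom{[N]}{3}$; an edge $\{i,j\}$ is written $ij$ and a face $\{i,j,k\}$ is written $ijk$. A function $I:E\to(-1,\infty)$, $I_{ij}=I(ij)$, assigns an inversive distance to each edge. A background geometry (Euclidean or hyperbolic) is fixed. "Closed" means compact without boundary. A radius function is a map $r:V\to(0,\infty)$, $r_i=r(i)$. It induces edge lengths $l_r:E\to(0,\infty)$ by $$l_r(ij)=\sqrt{r_i^2+r_j^2+2r_ir_jI_{ij}}$$ in the Euclidean case, and $$l_r(ij)=\cosh^{-1}\bigl(\cosh r_i\cosh r_j+I_{ij}\sinh r_i\sinh r_j\bigr)$$ in the hyperbolic case. The radius function $r$ is called a circle packing metric for $(S,\mathcal T,I)$ if for every face $ijk\in F$ the three lengths $l_r(ij),l_r(jk),l_r(ik)$ satisfy the strict triangle inequalities. In that case each face is realized as a Euclidean (resp. hyperbolic) triangle with these side lengths, and the discrete curvature at $i\in V$ is $K_r(i)=2\pi-\sum_{\tau\in F,\ i\in\tau}\theta_i^\tau$, where $\theta_i^\tau$ is the inner angle at vertex $i$ of the triangle $\tau$. *)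

theory Defs
  imports "HOL-Analysis.Analysis"
begin

definition surface_without_boundary :: "'a topology \<Rightarrow> bool" where
  "surface_without_boundary S \<longleftrightarrow>
     Hausdorff_space S \<and>
     (\<exists>\<B>. countable \<B> \<and> (\<forall>B\<in>\<B>. openin S B) \<and>
          (\<forall>U x. openin S U \<and> x \<in> U \<longrightarrow> (\<exists>B\<in>\<B>. x \<in> B \<and> B \<subseteq> U))) \<and>
     (\<forall>x\<in>topspace S. \<exists>U (W :: (real^2) set). openin S U \<and> x \<in> U \<and> open W \<and>
          subtopology S U homeomorphic_space top_of_set W)"

definition closed_surface :: "'a topology \<Rightarrow> bool" where
  "closed_surface S \<longleftrightarrow> surface_without_boundary S \<and> compact_space S"

definition simplicial_2_complex :: "nat \<Rightarrow> nat set set \<Rightarrow> nat set set \<Rightarrow> bool" where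
  "simplicial_2_complex N E F \<longleftrightarrow>
     (\<forall>e\<in>E. e \<subseteq> {1..N} \<and> card e = 2) \<and>
     (\<forall>f\<in>F. f \<subseteq> {1..N} \<and> card f = 3) \<and>
     (\<forall>f\<in>F. \<forall>e. e \<subseteq> f \<and> card e = 2 \<longrightarrow> e \<in> E)"

definition simplices :: "nat \<Rightarrow> nat set set \<Rightarrow> nat set set \<Rightarrow> nat set set" where
  "simplices N E F = (\<lambda>v. {v}) ` {1..N} \<union> E \<union> F"

text \<open>The geometric realization, in barycentric coordinates: points are the convex weights on
  the vertices whose support is a simplex. For a finite complex the usual topology is the
  subspace topology inherited from the product topology on \<^typ>\<open>nat \<Rightarrow> real\<close>.\<close>

definition geometric_realization :: "nat set set \<Rightarrow> (nat \<Rightarrow> real) topology" where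
  "geometric_realization K =
     top_of_set {x. (\<forall>v. 0 \<le> x v) \<and> {v. x v \<noteq> 0} \<in> K \<and> (\<Sum>v | x v \<noteq> 0. x v) = 1}"

definition triangulates :: "'a topology \<Rightarrow> nat \<Rightarrow> nat set set \<Rightarrow> nat set set \<Rightarrow> bool" where
  "triangulates S N E F \<longleftrightarrow>
     simplicial_2_complex N E F \<and>
     S homeomorphic_space geometric_realization (simplices N E F)"

datatype geometry = Euclidean | Hyperbolic

fun edge_length :: "geometry \<Rightarrow> (nat set \<Rightarrow> real) \<Rightarrow> (nat \<Rightarrow> real) \<Rightarrow> nat \<Rightarrow> nat \<Rightarrow> real" where
  "edge_length Euclidean I r i j = sqrt ((r i)\<^sup>2 + (r j)\<^sup>2 + 2 * r i * r j * I {i, j})"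
| "edge_length Hyperbolic I r i j =
     arcosh (cosh (r i) * cosh (r j) + I {i, j} * sinh (r i) * sinh (r j))"

definition circle_packing_metric ::
    "geometry \<Rightarrow> nat \<Rightarrow> nat set set \<Rightarrow> (nat set \<Rightarrow> real) \<Rightarrow> (nat \<Rightarrow> real) \<Rightarrow> bool" where
  "circle_packing_metric g N F I r \<longleftrightarrow>
     (\<forall>i\<in>{1..N}. 0 < r i) \<and>
     (\<forall>i j k. {i, j, k} \<in> F \<longrightarrow>
        edge_length g I r i k < edge_length g I r i j + edge_length g I r j k)"

definition euclidean_angle :: "real^2 \<Rightarrow> real^2 \<Rightarrow> real^2 \<Rightarrow> real" where
  "euclidean_angle x y z = arccos (((y - x) \<bullet> (z - x)) / (norm (y - x) * norm (z - x)))"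

text \<open>The hyperbolic plane is the upper sheet of the hyperboloid in Minkowski space.\<close>

definition lorentz :: "(real^2) \<times> real \<Rightarrow> (real^2) \<times> real \<Rightarrow> real" where
  "lorentz x y = fst x \<bullet> fst y - snd x * snd y"

definition hyperbolic_plane :: "((real^2) \<times> real) set" where
  "hyperbolic_plane = {x. lorentz x x = -1 \<and> snd x > 0}"

definition hyperbolic_dist :: "(real^2) \<times> real \<Rightarrow> (real^2) \<times> real \<Rightarrow> real" where
  "hyperbolic_dist x y = arcosh (- lorentz x y)"

text \<open>The Lorentz-orthogonal projection of \<open>y\<close> to the tangent plane at \<open>x\<close>, which is a positive
  multiple of the initial velocity of the geodesic from \<open>x\<close> to \<open>y\<close>.\<close>

definition hyperbolic_direction ::
    "(real^2) \<times> real \<Rightarrow> (real^2) \<times> real \<Rightarrow> (real^2) \<times> real" where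
  "hyperbolic_direction x y = y + lorentz x y *\<^sub>R x"

definition hyperbolic_angle ::
    "(real^2) \<times> real \<Rightarrow> (real^2) \<times> real \<Rightarrow> (real^2) \<times> real \<Rightarrow> real" where
  "hyperbolic_angle x y z =
     (let u = hyperbolic_direction x y; v = hyperbolic_direction x z
      in arccos (lorentz u v / (sqrt (lorentz u u) * sqrt (lorentz v v))))"

text \<open>The inner angle at \<open>i\<close> of the face \<open>\<tau>\<close>, measured in a triangle that realizes \<open>\<tau>\<close> with side
  lengths \<open>l\<close>. If \<open>l\<close> satisfies the strict triangle inequalities then such a triangle exists, and
  the angle depends neither on its choice nor on the order of the other two vertices.\<close>

definition inner_angle ::
    "geometry \<Rightarrow> (nat \<Rightarrow> nat \<Rightarrow> real) \<Rightarrow> nat set \<Rightarrow> nat \<Rightarrow> real" where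
  "inner_angle g l \<tau> i = (THE \<theta>. \<exists>j k. \<tau> = {i, j, k} \<and>
     (case g of
        Euclidean \<Rightarrow> \<exists>x y z. dist x y = l i j \<and> dist x z = l i k \<and> dist y z = l j k \<and>
          \<theta> = euclidean_angle x y z
      | Hyperbolic \<Rightarrow> \<exists>x\<in>hyperbolic_plane. \<exists>y\<in>hyperbolic_plane. \<exists>z\<in>hyperbolic_plane.
          hyperbolic_dist x y = l i j \<and> hyperbolic_dist x z = l i k \<and>
          hyperbolic_dist y z = l j k \<and> \<theta> = hyperbolic_angle x y z))"

definition curvature ::
    "geometry \<Rightarrow> nat set set \<Rightarrow> (nat set \<Rightarrow> real) \<Rightarrow> (nat \<Rightarrow> real) \<Rightarrow> nat \<Rightarrow> real" where
  "curvature g F I r i = 2 * pi - (\<Sum>\<tau> | \<tau> \<in> F \<and> i \<in> \<tau>. inner_angle g (edge_length g I r) \<tau> i)"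

end

theory Submission
  imports Defs
begin

text \<open>A maximum principle. Centre the circle of a vertex \<open>i\<close> at the origin, in the Poincare disk model
  in the hyperbolic case. The angle at \<open>i\<close> in a face then depends only on the Euclidean radii of
  the other two circles relative to that of \<open>i\<close>, and the hypotheses on \<open>I\<close> make it nondecreasing in
  each of them, and strictly increasing in at least one. Measure circles by \<open>r\<^sub>i\<close> in
  Euclidean and by \<open>tanh (r\<^sub>i / 2)\<close> in hyperbolic geometry, and let \<open>i\<close> maximize the ratio \<open>s\<close> of the sizes in \<open>r\<close> and in \<open>R\<close>. If
  \<open>s > 1\<close>, then \<open>i\<close> is in \<open>A\<close>, and all relative radii around \<open>i\<close> are at most as large for \<open>r\<close>
  as for \<open>R\<close>, strictly smaller in the hyperbolic case. So the angles at \<open>i\<close> are at most as large, and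
  the curvature inequality forces all of them to be equal. This is impossible in the hyperbolic case;
  in the Euclidean case it makes the set of maximizing vertices a union of faces, hence everything by
  connectedness, contrary to \<open>B \<noteq> {}\<close>.\<close>

subsection \<open>The angle as a function of relative radii\<close>

text \<open>The Euclidean law of cosines at the centre of a unit circle, for two further circles of
  radii \<open>x\<close> and \<open>y\<close>: \<open>a\<close> and \<open>b\<close> are their
  inversive distances to the unit circle and \<open>c\<close> is the one between them. The radicands
  are squared side lengths.\<close>

definition wedge_cos :: "real \<Rightarrow> real \<Rightarrow> real \<Rightarrow> real \<Rightarrow> real \<Rightarrow> real" where
  "wedge_cos a b c x y =
     (1 + a * x + b * y - c * x * y) / (sqrt (1 + x\<^sup>2 + 2 * a * x) * sqrt (1 + y\<^sup>2 + 2 * b * y))"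

lemma wedge_cos_commute: "wedge_cos a b c x y = wedge_cos b a c y x"
  unfolding wedge_cos_def by (simp add: algebra_simps)

lemma one_plus_square_pos:
  fixes a x :: real
  assumes "-1 < a" "0 < x"
  shows "0 < 1 + x\<^sup>2 + 2 * a * x"
proof -
  have "0 < (1 - x)\<^sup>2 + 2 * (1 + a) * x"
    using assms by (intro add_nonneg_pos) auto
  then show ?thesis by (simp add: power2_eq_square algebra_simps)
qed

text \<open>Squared denominator minus squared numerator is a Gram determinant, four times the
  squared area of the triangle. Its expansion in \<open>x\<close> and \<open>y\<close> has only
  coefficients that are nonnegative by hypothesis.\<close>

lemma abs_wedge_cos_le_1:
  assumes "-1 < a" "a \<le> 1" "-1 < b" "b \<le> 1" "-1 < c" "c \<le> 1" "0 < x" "0 < y"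
    and "0 \<le> c + a * b" "0 \<le> b + a * c" "0 \<le> a + b * c"
  shows "\<bar>wedge_cos a b c x y\<bar> \<le> 1"
proof -
  let ?n = "1 + a * x + b * y - c * x * y"
    and ?u = "1 + x\<^sup>2 + 2 * a * x" and ?v = "1 + y\<^sup>2 + 2 * b * y"
  have sq: "t\<^sup>2 \<le> 1" if "-1 < t" "t \<le> 1" for t :: real
    using that by (simp add: abs_square_le_1 abs_le_iff)
  have "0 \<le> x\<^sup>2 * (1 - a\<^sup>2) + y\<^sup>2 * (1 - b\<^sup>2) + (x * y)\<^sup>2 * (1 - c\<^sup>2)
      + 2 * (x * y) * (c + a * b) + 2 * (x\<^sup>2 * y) * (b + a * c) + 2 * (x * y\<^sup>2) * (a + b * c)"
    using assms sq[of a] sq[of b] sq[of c]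
    by (intro add_nonneg_nonneg; intro mult_nonneg_nonneg[of "_ * _"] mult_nonneg_nonneg[of "_\<^sup>2"]) auto
  also have "\<dots> = ?u * ?v - ?n\<^sup>2"
    by algebra
  finally have "\<bar>?n\<bar> \<le> sqrt (?u * ?v)"
    by (intro real_le_rsqrt) simp
  moreover have "0 < sqrt (?u * ?v)"
    using one_plus_square_pos[of a x] one_plus_square_pos[of b y] assms by simp
  ultimately show ?thesis
    unfolding wedge_cos_def real_sqrt_mult[symmetric] by (simp add: abs_divide divide_le_eq)
qed

text \<open>With \<open>p = a - c * y\<close> and \<open>q = 1 + b * y\<close>, the derivative of the quotient in \<open>x\<close> has the
  sign of a linear function of \<open>x\<close>, whose two coefficients are
  \<open>- ((1 - a\<^sup>2) + y * (b + a * c))\<close> and \<open>- y * (c + a * b)\<close>.\<close>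

lemma wedge_cos_strict_antimono:
  assumes "-1 < a" "a \<le> 1" "-1 < b" "0 < x" "x < x'" "0 < y"
    and nonneg: "0 \<le> c + a * b" "0 \<le> b + a * c"
    and nondeg: "\<not> (a = 1 \<and> b = - c)"
  shows "wedge_cos a b c x' y < wedge_cos a b c x y"
proof -
  define p q where "p = a - c * y" and "q = 1 + b * y"
  have eq: "wedge_cos a b c t y = (p * t + q) / sqrt (1 + t\<^sup>2 + 2 * a * t) / sqrt (1 + y\<^sup>2 + 2 * b * y)"
    for t by (simp add: wedge_cos_def p_def q_def algebra_simps)
  have "(p * x + q) / sqrt (1 + x\<^sup>2 + 2 * a * x) > (p * x' + q) / sqrt (1 + x'\<^sup>2 + 2 * a * x')"
  proof (rule DERIV_neg_imp_decreasing[OF \<open>x < x'\<close>])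
    fix t assume t: "x \<le> t" "t \<le> x'"
    then have "0 < t" using assms by simp
    let ?u = "1 + t\<^sup>2 + 2 * a * t"
    have u: "0 < ?u" using one_plus_square_pos[of a t] assms \<open>0 < t\<close> by simp
    have a2: "a\<^sup>2 \<le> 1" using assms by (simp add: abs_square_le_1 abs_le_iff)
    have "t * ((1 - a\<^sup>2) + y * (b + a * c)) + y * (c + a * b) > 0"
    proof (cases "a = 1")
      case True
      \<comment> \<open>Now \<open>1 - a\<^sup>2\<close> vanishes and both remaining coefficients
        become \<open>b + c\<close>, which is zero only in the excluded case.\<close>
      then have "0 < b + c" using nonneg nondeg by auto
      then show ?thesis using True \<open>0 < t\<close> \<open>0 < y\<close> by (simp add: add_pos_pos add.commute)
    next
      case False
      then have "a\<^sup>2 < 1" using assms by (simp add: abs_square_less_1 abs_less_iff)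
      then show ?thesis using \<open>0 < t\<close> \<open>0 < y\<close> nonneg
        by (intro add_pos_nonneg mult_pos_pos mult_nonneg_nonneg) auto
    qed
    moreover have "p * ?u - (p * t + q) * (t + a) = - (t * ((1 - a\<^sup>2) + y * (b + a * c)) + y * (c + a * b))"
      unfolding p_def q_def by algebra
    ultimately have neg: "p * ?u - (p * t + q) * (t + a) < 0" by simp
    have "((\<lambda>t. (p * t + q) / sqrt (1 + t\<^sup>2 + 2 * a * t)) has_real_derivative
        (p * ?u - (p * t + q) * (t + a)) / (?u * sqrt ?u)) (at t)"
      using u by (auto intro!: derivative_eq_intros simp: divide_simps) (auto simp: algebra_simps)
    moreover have "(p * ?u - (p * t + q) * (t + a)) / (?u * sqrt ?u) < 0"
      using neg u by (intro divide_neg_pos) auto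
    ultimately show "\<exists>D. DERIV (\<lambda>t. (p * t + q) / sqrt (1 + t\<^sup>2 + 2 * a * t)) t :> D \<and> D < 0"
      by blast
  qed
  then show ?thesis
    unfolding eq using one_plus_square_pos[of b y] assms by (intro divide_strict_right_mono) auto
qed

text \<open>The numerator and the root depending on \<open>x\<close> share the factor
  \<open>1 + x\<close>, which cancels. In this one configuration the angle ignores the radius
  \<open>x\<close>, so strictness has to exclude it.\<close>

lemma wedge_cos_degenerate:
  assumes "0 < x" "0 < x'"
  shows "wedge_cos 1 (- c) c x y = wedge_cos 1 (- c) c x' y"
proof -
  have "(1 + t - c * y - c * t * y) / sqrt (1 + t\<^sup>2 + 2 * t) = 1 - c * y" if "0 < t" for t :: real
  proof -
    have "1 + t\<^sup>2 + 2 * t = (1 + t)\<^sup>2" by algebra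
    then have "sqrt (1 + t\<^sup>2 + 2 * t) = 1 + t" using that by simp
    moreover have "1 + t - c * y - c * t * y = (1 - c * y) * (1 + t)" by algebra
    ultimately show ?thesis using that by simp
  qed
  from this[OF assms(1)] this[OF assms(2)] show ?thesis
    by (simp add: wedge_cos_def flip: divide_divide_eq_left)
qed

lemma wedge_cos_antimono:
  assumes "-1 < a" "a \<le> 1" "-1 < b" "0 < x" "x \<le> x'" "0 < y"
    and "0 \<le> c + a * b" "0 \<le> b + a * c"
  shows "wedge_cos a b c x' y \<le> wedge_cos a b c x y"
proof (cases "x = x'")
  case False
  show ?thesis
  proof (cases "a = 1 \<and> b = - c")
    case True
    then show ?thesis using wedge_cos_degenerate[of x x' c y] assms by simp
  next
    case False
    then show ?thesis using wedge_cos_strict_antimono[of a b x x' y c] \<open>x \<noteq> x'\<close> assms by simp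
  qed
qed simp

text \<open>The radii are changed one at a time, \<open>y\<close> first by symmetry. Strictness is
  recorded only for \<open>x\<close>; the other neighbour is covered by exchanging the two.\<close>

lemma wedge_cos_antimono2:
  assumes "-1 < a" "a \<le> 1" "-1 < b" "b \<le> 1" "0 < x" "x \<le> x'" "0 < y" "y \<le> y'"
    and "0 \<le> c + a * b" "0 \<le> b + a * c" "0 \<le> a + b * c"
  shows "wedge_cos a b c x' y' \<le> wedge_cos a b c x y"
    and "\<lbrakk>x < x'; \<not> (a = 1 \<and> b = - c)\<rbrakk> \<Longrightarrow> wedge_cos a b c x' y' < wedge_cos a b c x y"
proof -
  have 1: "wedge_cos a b c x' y' \<le> wedge_cos a b c x' y"
    using wedge_cos_antimono[of b a y y' x' c] assms
    by (simp add: wedge_cos_commute[of a] mult.commute)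
  also have "\<dots> \<le> wedge_cos a b c x y"
    by (rule wedge_cos_antimono) (use assms in auto)
  finally show "wedge_cos a b c x' y' \<le> wedge_cos a b c x y" .
  assume "x < x'" "\<not> (a = 1 \<and> b = - c)"
  then have "wedge_cos a b c x' y < wedge_cos a b c x y"
    using assms by (intro wedge_cos_strict_antimono) auto
  with 1 show "wedge_cos a b c x' y' < wedge_cos a b c x y" by simp
qed

section \<open>Radii relative to the circle at the chosen vertex\<close>

fun radius_scale :: "geometry \<Rightarrow> real \<Rightarrow> real" where
  "radius_scale Euclidean \<rho> = \<rho>"
| "radius_scale Hyperbolic \<rho> = tanh (\<rho> / 2)"

text \<open>In the hyperbolic case the circle at \<open>i\<close> is centred at the origin of the Poincare disk,
  where it has Euclidean radius \<open>tanh (r\<^sub>i / 2)\<close>; the value below is the ratio of the Euclidean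
  radius of the circle at \<open>j\<close> to it. Since inversive distances are the same in the disk metric and
  in the Euclidean metric, and so are the angles at the origin, both geometries share
  the formula \<open>wedge_cos\<close> for the angle at \<open>i\<close>.\<close>

fun relative_radius :: "geometry \<Rightarrow> real \<Rightarrow> real \<Rightarrow> real \<Rightarrow> real" where
  "relative_radius Euclidean c a b = b / a"
| "relative_radius Hyperbolic c a b = (b / a) * ((1 - a\<^sup>2) / (1 + b\<^sup>2 + 2 * c * a * b))"

lemma radius_scale_pos: "0 < \<rho> \<Longrightarrow> 0 < radius_scale g \<rho>"
  by (cases g) auto

lemma radius_scale_le_iff: "radius_scale g \<rho> \<le> radius_scale g \<rho>' \<longleftrightarrow> \<rho> \<le> \<rho>'"
  by (cases g) auto

lemma radius_scale_less_1: "radius_scale Hyperbolic \<rho> < 1"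
  by (simp add: tanh_real_lt_1)

lemma inversive_denom_pos:
  fixes c a b :: real
  assumes "-1 < c" "0 < a" "a < 1" "0 < b"
  shows "0 < 1 + b\<^sup>2 + 2 * c * a * b"
proof -
  have "c * (a * b) \<ge> - (a * b)"
    using assms mult_right_mono[of "-1" c "a * b"] by simp
  moreover have "a * b < b" using assms by simp
  moreover have "0 \<le> (1 - b)\<^sup>2" by simp
  ultimately show ?thesis by (simp add: power2_eq_square algebra_simps)
qed

lemma relative_radius_pos:
  assumes "-1 < c" "0 < a" "0 < b" "g = Hyperbolic \<Longrightarrow> a < 1"
  shows "0 < relative_radius g c a b"
proof (cases g)
  case Hyperbolic
  then have "0 < 1 + b\<^sup>2 + 2 * c * a * b" "a\<^sup>2 < 1"
    using assms inversive_denom_pos by (auto simp: abs_square_less_1)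
  then show ?thesis using assms Hyperbolic by simp
qed (use assms in auto)

text \<open>In the hyperbolic case, cross-multiplying cancels the terms with \<open>c\<close> and
  leaves \<open>(b' - b) * (1 - b * b')\<close>, nonnegative because both sizes are below 1.\<close>

lemma relative_radius_mono:
  fixes c a b b' :: real
  assumes "-1 < c" "0 < a" "0 < b" "b \<le> b'" "g = Hyperbolic \<Longrightarrow> a < 1 \<and> b' < 1"
  shows "relative_radius g c a b \<le> relative_radius g c a b'"
proof (cases g)
  case Hyperbolic
  have pos: "0 < 1 + b\<^sup>2 + 2 * c * a * b" "0 < 1 + b'\<^sup>2 + 2 * c * a * b'" "a\<^sup>2 < 1"
    using assms inversive_denom_pos Hyperbolic by (auto simp: abs_square_less_1)
  have "b * b' \<le> 1" using assms Hyperbolic mult_mono[of b 1 b' 1] by simp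
  then have "0 \<le> (b' - b) * (1 - b * b')" using assms by simp
  then have "b * (1 + b'\<^sup>2 + 2 * c * a * b') \<le> b' * (1 + b\<^sup>2 + 2 * c * a * b)"
    by (simp add: power2_eq_square algebra_simps)
  then have "b / (1 + b\<^sup>2 + 2 * c * a * b) \<le> b' / (1 + b'\<^sup>2 + 2 * c * a * b')"
    using pos by (simp add: divide_simps)
  then have "(1 - a\<^sup>2) / a * (b / (1 + b\<^sup>2 + 2 * c * a * b))
      \<le> (1 - a\<^sup>2) / a * (b' / (1 + b'\<^sup>2 + 2 * c * a * b'))"
    using pos assms by (intro mult_left_mono) auto
  then show ?thesis using Hyperbolic by (simp add: mult_ac)
qed (use assms in \<open>auto simp: divide_right_mono\<close>)

text \<open>Scaling keeps \<open>b / a\<close> but shrinks the second factor: the cross products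
  differ by \<open>s\<^sup>2 - 1\<close> times the positive form
  \<open>a\<^sup>2 + b\<^sup>2 + 2 * c * a * b\<close>. This failure of scale invariance separates
  the two geometries.\<close>

lemma relative_radius_scale_hyperbolic:
  fixes c a b s :: real
  assumes "-1 < c" "0 < a" "a < 1" "0 < b" "1 < s" "s * a < 1"
  shows "relative_radius Hyperbolic c (s * a) (s * b) < relative_radius Hyperbolic c a b"
proof -
  let ?u = "b\<^sup>2 + 2 * c * a * b"
  have sq: "1 < s\<^sup>2" using assms by simp
  have pos: "0 < 1 + ?u" "0 < 1 + s\<^sup>2 * ?u"
    using inversive_denom_pos[of c a b] inversive_denom_pos[of c "s * a" "s * b"] assms
    by (simp_all add: power2_eq_square algebra_simps)
  have "0 < (a - b)\<^sup>2 + 2 * ((1 + c) * (a * b))"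
    using assms by (intro add_nonneg_pos) auto
  then have "0 < a\<^sup>2 + ?u" by (simp add: power2_eq_square algebra_simps)
  then have "0 < (s\<^sup>2 - 1) * (a\<^sup>2 + ?u)" using sq by simp
  also have "\<dots> = (1 - a\<^sup>2) * (1 + s\<^sup>2 * ?u) - (1 - s\<^sup>2 * a\<^sup>2) * (1 + ?u)" by algebra
  finally have "(1 - s\<^sup>2 * a\<^sup>2) / (1 + s\<^sup>2 * ?u) < (1 - a\<^sup>2) / (1 + ?u)"
    using pos by (simp add: divide_simps)
  then have "b / a * ((1 - s\<^sup>2 * a\<^sup>2) / (1 + s\<^sup>2 * ?u)) < b / a * ((1 - a\<^sup>2) / (1 + ?u))"
    using assms by (intro mult_strict_left_mono) auto
  then show ?thesis using assms
    by (simp add: power2_eq_square algebra_simps)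
qed

text \<open>In the hyperbolic case, first scale \<open>a\<close> and \<open>b' / s\<close> by
  \<open>s\<close>, which is strict, then enlarge \<open>b' / s\<close> to \<open>b\<close>. In the
  Euclidean case \<open>s\<close> cancels, so equality occurs exactly when
  \<open>b' = s * b\<close>.\<close>

lemma relative_radius_compare:
  fixes c a b b' s :: real
  assumes "-1 < c" "0 < a" "0 < b" "0 < b'" "1 < s" "b' \<le> s * b"
    and "g = Hyperbolic \<Longrightarrow> a < 1 \<and> b < 1 \<and> s * a < 1 \<and> b' < 1"
  shows "relative_radius g c (s * a) b' \<le> relative_radius g c a b"
    and "g = Hyperbolic \<or> b' \<noteq> s * b \<Longrightarrow> relative_radius g c (s * a) b' < relative_radius g c a b"
proof -
  have hyp: "relative_radius g c (s * a) b' < relative_radius g c a b" if "g = Hyperbolic"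
  proof -
    have "relative_radius g c (s * a) (s * (b' / s)) < relative_radius g c a (b' / s)"
      using assms that unfolding that by (intro relative_radius_scale_hyperbolic) auto
    also have "\<dots> \<le> relative_radius g c a b"
      using assms that by (intro relative_radius_mono) (auto simp: field_simps)
    finally show ?thesis using assms by simp
  qed
  show "relative_radius g c (s * a) b' \<le> relative_radius g c a b"
    using hyp assms by (cases g) (auto simp: field_simps)
  show "relative_radius g c (s * a) b' < relative_radius g c a b" if "g = Hyperbolic \<or> b' \<noteq> s * b"
    using hyp assms that by (cases g) (auto simp: field_simps)
qed

subsection \<open>Triangles with prescribed side lengths\<close>

fun law_of_cosines :: "geometry \<Rightarrow> real \<Rightarrow> real \<Rightarrow> real \<Rightarrow> real" where
  "law_of_cosines Euclidean a b c = (a\<^sup>2 + b\<^sup>2 - c\<^sup>2) / (2 * a * b)"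
| "law_of_cosines Hyperbolic a b c = (cosh a * cosh b - cosh c) / (sinh a * sinh b)"

lemma law_of_cosines_commute: "law_of_cosines g a b c = law_of_cosines g b a c"
  by (cases g) (simp_all add: algebra_simps)

lemma norm_vector_2: "norm (vector [p, q] :: real^2) = sqrt (p\<^sup>2 + q\<^sup>2)"
  by (simp add: norm_eq_sqrt_inner inner_vec_def sum_2 power2_eq_square)

lemma inner_vector_2: "(vector [p, q] :: real^2) \<bullet> vector [p', q'] = p * p' + q * q'"
  by (simp add: inner_vec_def sum_2)

lemma euclidean_angle_eq:
  assumes "dist x y = a" "dist x z = b" "dist y z = c"
  shows "euclidean_angle x y z = arccos (law_of_cosines Euclidean a b c)"
proof -
  have "(y - x) \<bullet> (z - x) = ((norm (y - x))\<^sup>2 + (norm (z - x))\<^sup>2 - (norm ((y - x) - (z - x)))\<^sup>2) / 2"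
    by (simp add: dot_norm_neg)
  also have "\<dots> = (a\<^sup>2 + b\<^sup>2 - c\<^sup>2) / 2"
    using assms by (simp add: dist_norm norm_minus_commute)
  finally have "euclidean_angle x y z = arccos ((a\<^sup>2 + b\<^sup>2 - c\<^sup>2) / 2 / (a * b))"
    using assms unfolding euclidean_angle_def by (metis dist_norm dist_commute)
  then show ?thesis by (simp add: mult.assoc)
qed

text \<open>One vertex is the origin, one lies on the first axis, and the third is in the direction
  whose cosine is \<open>t\<close>. Degenerate triangles are allowed.\<close>

lemma euclidean_triangle_exists:
  assumes "0 < a" "0 < b" "0 \<le> c" "\<bar>law_of_cosines Euclidean a b c\<bar> \<le> 1"
  obtains x y z :: "real^2" where "dist x y = a" "dist x z = b" "dist y z = c"
proof -
  define t where "t = law_of_cosines Euclidean a b c"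
  have t2: "t\<^sup>2 \<le> 1" using assms(4) by (simp add: t_def abs_square_le_1)
  have ct: "c\<^sup>2 = a\<^sup>2 + b\<^sup>2 - 2 * a * b * t" using assms by (simp add: t_def field_simps)
  define y z :: "real^2" where "y = vector [a, 0]" and "z = vector [b * t, b * sqrt (1 - t\<^sup>2)]"
  have "dist 0 y = a" using assms by (simp add: y_def norm_vector_2)
  moreover have "(b * t)\<^sup>2 + (b * sqrt (1 - t\<^sup>2))\<^sup>2 = b\<^sup>2"
    using t2 by (simp add: power_mult_distrib algebra_simps)
  then have zz: "z \<bullet> z = b\<^sup>2" unfolding z_def inner_vector_2 by (simp add: power2_eq_square)
  then have "dist 0 z = b" using assms by (simp add: norm_eq_sqrt_inner)
  moreover have "(y - z) \<bullet> (y - z) = c\<^sup>2"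
    using zz unfolding ct by (simp add: inner_diff inner_commute y_def z_def inner_vector_2 power2_eq_square)
  then have "dist y z = c" using assms by (simp add: dist_norm norm_eq_sqrt_inner)
  ultimately show ?thesis using that by blast
qed

section \<open>Triangles on the hyperboloid\<close>

text \<open>The reversed Cauchy-Schwarz inequality on the upper sheet. It puts the argument of
  \<open>arcosh\<close> in \<open>hyperbolic_dist\<close> into the range where \<open>cosh\<close>
  inverts it.\<close>

lemma lorentz_le_minus_one:
  assumes "x \<in> hyperbolic_plane" "y \<in> hyperbolic_plane"
  shows "lorentz x y \<le> -1"
proof -
  let ?p = "norm (fst x)" and ?q = "norm (fst y)"
  have x: "(snd x)\<^sup>2 = 1 + ?p\<^sup>2" "0 < snd x" and y: "(snd y)\<^sup>2 = 1 + ?q\<^sup>2" "0 < snd y"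
    using assms by (simp_all add: hyperbolic_plane_def lorentz_def power2_eq_square dot_square_norm algebra_simps)
  have "(1 + ?p * ?q)\<^sup>2 \<le> (1 + ?p\<^sup>2) * (1 + ?q\<^sup>2)"
    using zero_le_power2[of "?p - ?q"] by (simp add: power2_eq_square algebra_simps)
  also have "\<dots> = (snd x * snd y)\<^sup>2" using x y by (simp add: power_mult_distrib)
  finally have "1 + ?p * ?q \<le> snd x * snd y"
    using x y by (auto intro: power2_le_imp_le)
  moreover have "fst x \<bullet> fst y \<le> ?p * ?q" by (rule norm_cauchy_schwarz)
  ultimately show ?thesis by (simp add: lorentz_def)
qed

lemma cosh_hyperbolic_dist:
  assumes "x \<in> hyperbolic_plane" "y \<in> hyperbolic_plane"
  shows "cosh (hyperbolic_dist x y) = - lorentz x y"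
  using lorentz_le_minus_one[OF assms] by (simp add: hyperbolic_dist_def)

lemma lorentz_hyperbolic_direction:
  assumes "x \<in> hyperbolic_plane"
  shows "lorentz (hyperbolic_direction x y) (hyperbolic_direction x z)
    = lorentz y z + lorentz x y * lorentz x z"
proof -
  have "lorentz x x = -1" using assms by (simp add: hyperbolic_plane_def)
  moreover have "lorentz (y + s *\<^sub>R x) (z + t *\<^sub>R x)
      = lorentz y z + t * lorentz x y + s * lorentz x z + s * t * lorentz x x" for s t
    by (simp add: lorentz_def inner_add algebra_simps inner_commute)
  ultimately show ?thesis by (simp add: hyperbolic_direction_def)
qed

lemma hyperbolic_angle_eq:
  assumes "x \<in> hyperbolic_plane" "y \<in> hyperbolic_plane" "z \<in> hyperbolic_plane"
    and d: "hyperbolic_dist x y = a" "hyperbolic_dist x z = b" "hyperbolic_dist y z = c"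
    and "0 < a" "0 < b"
  shows "hyperbolic_angle x y z = arccos (law_of_cosines Hyperbolic a b c)"
proof -
  have l: "lorentz x y = - cosh a" "lorentz x z = - cosh b" "lorentz y z = - cosh c"
    using cosh_hyperbolic_dist assms by fastforce+
  have 1: "lorentz y y = -1" "lorentz z z = -1"
    using assms by (simp_all add: hyperbolic_plane_def)
  have "sqrt ((cosh t)\<^sup>2 - 1) = sinh t" if "0 < t" for t :: real
    using that by (simp add: cosh_square_eq)
  then show ?thesis
    using assms(7,8) unfolding hyperbolic_angle_def Let_def lorentz_hyperbolic_direction[OF assms(1)] l 1
    by (simp add: power2_eq_square)
qed

text \<open>The Euclidean construction carried over: \<open>x\<close> is the apex of the
  hyperboloid, and the horizontal parts of \<open>y\<close> and \<open>z\<close> enclose an angle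
  with cosine \<open>t\<close>.\<close>

lemma hyperbolic_triangle_exists:
  assumes "0 < a" "0 < b" "0 \<le> c" "\<bar>law_of_cosines Hyperbolic a b c\<bar> \<le> 1"
  obtains x y z where "x \<in> hyperbolic_plane" "y \<in> hyperbolic_plane" "z \<in> hyperbolic_plane"
    "hyperbolic_dist x y = a" "hyperbolic_dist x z = b" "hyperbolic_dist y z = c"
proof -
  define t where "t = law_of_cosines Hyperbolic a b c"
  have t2: "t\<^sup>2 \<le> 1" using assms(4) by (simp add: t_def abs_square_le_1)
  have ct: "cosh c = cosh a * cosh b - sinh a * sinh b * t" using assms by (simp add: t_def)
  define x y z :: "(real^2) \<times> real" where "x = (0, 1)"
    and "y = (vector [sinh a, 0], cosh a)"
    and "z = (vector [sinh b * t, sinh b * sqrt (1 - t\<^sup>2)], cosh b)"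
  have "(sinh b * t)\<^sup>2 + (sinh b * sqrt (1 - t\<^sup>2))\<^sup>2 = (sinh b)\<^sup>2"
    using t2 by (simp add: power_mult_distrib algebra_simps)
  then have "lorentz z z = -1"
    unfolding z_def lorentz_def by (simp add: inner_vector_2 sinh_square_eq flip: power2_eq_square)
  then have "x \<in> hyperbolic_plane" "y \<in> hyperbolic_plane" "z \<in> hyperbolic_plane"
    by (simp_all add: hyperbolic_plane_def)
       (simp_all add: x_def y_def z_def lorentz_def inner_vector_2 cosh_square_eq flip: power2_eq_square)
  moreover have "hyperbolic_dist x y = a" "hyperbolic_dist x z = b"
    using assms by (simp_all add: hyperbolic_dist_def x_def y_def z_def lorentz_def arcosh_cosh_real)
  moreover have "- lorentz y z = cosh c"
    unfolding ct by (simp add: y_def z_def lorentz_def inner_vector_2)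
  then have "hyperbolic_dist y z = c"
    using assms by (simp add: hyperbolic_dist_def arcosh_cosh_real)
  ultimately show ?thesis using that by blast
qed

text \<open>The law of cosines determines the angle in every realizing triangle, and it is symmetric
  in the other two vertices; the bound provides a realizing triangle. Hence the definite description
  is well defined.\<close>

lemma inner_angle_eq:
  assumes sym: "\<And>p q. l p q = l q p" and distinct: "i \<noteq> j" "i \<noteq> k" "j \<noteq> k"
    and pos: "0 < l i j" "0 < l i k" "0 < l j k"
    and bound: "\<bar>law_of_cosines g (l i j) (l i k) (l j k)\<bar> \<le> 1"
  shows "inner_angle g l {i, j, k} i = arccos (law_of_cosines g (l i j) (l i k) (l j k))"
proof -
  let ?realizes = "\<lambda>j k \<theta>. case g of
        Euclidean \<Rightarrow> \<exists>x y z. dist x y = l i j \<and> dist x z = l i k \<and> dist y z = l j k \<and>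
          \<theta> = euclidean_angle x y z
      | Hyperbolic \<Rightarrow> \<exists>x\<in>hyperbolic_plane. \<exists>y\<in>hyperbolic_plane. \<exists>z\<in>hyperbolic_plane.
          hyperbolic_dist x y = l i j \<and> hyperbolic_dist x z = l i k \<and>
          hyperbolic_dist y z = l j k \<and> \<theta> = hyperbolic_angle x y z"
  have unique: "\<theta> = arccos (law_of_cosines g (l i j') (l i k') (l j' k'))"
    if "?realizes j' k' \<theta>" "0 < l i j'" "0 < l i k'" for j' k' \<theta>
    using that euclidean_angle_eq hyperbolic_angle_eq by (cases g) auto
  have "\<exists>\<theta>. ?realizes j k \<theta>"
  proof (cases g)
    case Euclidean
    obtain x y z :: "real^2" where "dist x y = l i j" "dist x z = l i k" "dist y z = l j k"
      using euclidean_triangle_exists[OF pos(1,2) less_imp_le[OF pos(3)] bound[unfolded Euclidean]]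
      by blast
    then show ?thesis unfolding Euclidean geometry.case by blast
  next
    case Hyperbolic
    obtain x y z where "x \<in> hyperbolic_plane" "y \<in> hyperbolic_plane" "z \<in> hyperbolic_plane"
      "hyperbolic_dist x y = l i j" "hyperbolic_dist x z = l i k" "hyperbolic_dist y z = l j k"
      using hyperbolic_triangle_exists[OF pos(1,2) less_imp_le[OF pos(3)] bound[unfolded Hyperbolic]]
      by blast
    then show ?thesis unfolding Hyperbolic geometry.case by blast
  qed
  then obtain \<theta> where \<theta>: "?realizes j k \<theta>" by (elim exE)
  have ex: "?realizes j k (arccos (law_of_cosines g (l i j) (l i k) (l j k)))"
    by (rule subst[where P = "?realizes j k", OF unique[OF \<theta> pos(1,2)] \<theta>])
  show ?thesis
    unfolding inner_angle_def
  proof (rule the_equality)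
    show "\<exists>j' k'. {i, j, k} = {i, j', k'} \<and> ?realizes j' k' (arccos (law_of_cosines g (l i j) (l i k) (l j k)))"
      by (rule exI[of _ j], rule exI[of _ k], rule conjI[OF refl ex])
  next
    fix \<theta> assume "\<exists>j' k'. {i, j, k} = {i, j', k'} \<and> ?realizes j' k' \<theta>"
    then obtain j' k' where eq: "{i, j, k} = {i, j', k'}" and real: "?realizes j' k' \<theta>" by (elim exE conjE)
    have "j \<in> {i, j', k'}" "k \<in> {i, j', k'}" using eq by blast+
    then have "j = j' \<and> k = k' \<or> j = k' \<and> k = j'" using distinct by auto
    then show "\<theta> = arccos (law_of_cosines g (l i j) (l i k) (l j k))"
      using unique[OF real] pos sym[of j k] law_of_cosines_commute[of g "l i j"] by auto
  qed
qed

subsection \<open>Triangulated surfaces are pure and connected through faces\<close>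

text \<open>The set is the open star of the vertex \<open>v\<close>.\<close>

lemma openin_geometric_realization_support:
  "openin (geometric_realization K) {x \<in> topspace (geometric_realization K). x v \<noteq> 0}"
proof -
  have "open ((\<lambda>x::nat \<Rightarrow> real. x v) -` (- {0}))"
    by (rule open_vimage) auto
  then show ?thesis
    unfolding geometric_realization_def openin_open by auto
qed

lemma topspace_geometric_realization:
  "x \<in> topspace (geometric_realization K) \<longleftrightarrow>
     (\<forall>v. 0 \<le> x v) \<and> {v. x v \<noteq> 0} \<in> K \<and> (\<Sum>v | x v \<noteq> 0. x v) = 1"
  by (simp add: geometric_realization_def)

text \<open>In a chart, \<open>U\<close> contains a copy of a nonempty open subset of the plane, and
  invariance of dimension forbids a continuous injection of that into the line.\<close>

lemma no_injection_from_surface_to_line: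
  fixes f :: "'a \<Rightarrow> real"
  assumes S: "surface_without_boundary S" and U: "openin S U" "U \<noteq> {}"
    and cont: "continuous_map (subtopology S U) euclideanreal f" and inj: "inj_on f U"
  shows False
proof -
  obtain x where x: "x \<in> U" using U by auto
  then have "x \<in> topspace S" using U openin_subset by blast
  then obtain C and W :: "(real^2) set" where C: "openin S C" "x \<in> C" "open W"
    and hom: "subtopology S C homeomorphic_space top_of_set W"
    using S unfolding surface_without_boundary_def by meson
  obtain h k where hk: "homeomorphic_maps (subtopology S C) (top_of_set W) h k"
    using hom homeomorphic_space_def by blast
  have tC: "topspace (subtopology S C) = C" using C openin_subset by fastforce
  have kc: "continuous_map (top_of_set W) (subtopology S C) k"
    and kh: "\<And>y. y \<in> W \<Longrightarrow> h (k y) = y" and hh: "\<And>y. y \<in> C \<Longrightarrow> k (h y) = y"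
    and hc: "continuous_map (subtopology S C) (top_of_set W) h"
    using hk unfolding homeomorphic_maps_def tC by auto
  define W' where "W' = {y \<in> W. k y \<in> U}"
  have "openin (top_of_set W) {y \<in> topspace (top_of_set W). k y \<in> C \<inter> U}"
    by (rule openin_continuous_map_preimage[OF kc]) (use U C in \<open>auto simp: openin_subtopology\<close>)
  moreover have "{y \<in> topspace (top_of_set W). k y \<in> C \<inter> U} = W'"
    using continuous_map_image_subset_topspace[OF kc] tC by (auto simp: W'_def)
  ultimately have oW': "open W'"
    using C(3) by (simp add: openin_open_eq)
  have "h x \<in> W'"
    using continuous_map_image_subset_topspace[OF hc] C x hh tC by (auto simp: W'_def)
  have "continuous_map (subtopology (top_of_set W) W') (subtopology S U) k"
    using kc by (auto simp: continuous_map_in_subtopology W'_def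
        intro: continuous_map_from_subtopology)
  then have "continuous_map (subtopology (top_of_set W) W') euclideanreal (f \<circ> k)"
    using cont continuous_map_compose by blast
  moreover have "W \<inter> W' = W'" by (auto simp: W'_def)
  ultimately have "continuous_on W' (f \<circ> k)"
    by (simp add: subtopology_subtopology)
  moreover have "inj_on (f \<circ> k) W'"
    by (rule inj_onI) (metis (mono_tags, lifting) W'_def comp_apply inj inj_onD kh mem_Collect_eq)
  ultimately have "DIM(real^2) \<le> DIM(real)"
    using invariance_of_dimension_subspaces[of UNIV W' UNIV "f \<circ> k"] oW' \<open>h x \<in> W'\<close>
    by (auto simp: dim_UNIV)
  then show False by simp
qed

text \<open>An open set that meets no open face contains an open subset of a single edge or vertex, on
  which one barycentric coordinate is injective.\<close>

lemma open_set_meets_face: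
  assumes S: "surface_without_boundary S" and T: "triangulates S N E F"
    and U: "openin (geometric_realization (simplices N E F)) U" "U \<noteq> {}"
  obtains x where "x \<in> U" "{v. x v \<noteq> 0} \<in> F"
proof (rule ccontr)
  assume "\<not> thesis"
  then have not: "{v. x v \<noteq> 0} \<notin> F" if "x \<in> U" for x
    using \<open>\<And>x. x \<in> U \<Longrightarrow> {v. x v \<noteq> 0} \<in> F \<Longrightarrow> thesis\<close> that by blast
  let ?G = "geometric_realization (simplices N E F)"
  have pair: "\<exists>i j. A = {i, j}" if "A \<in> E" for A
  proof -
    have "card A = 2" using T that by (simp add: triangulates_def simplicial_2_complex_def)
    then show ?thesis by (auto simp: card_2_iff)
  qed
  \<comment> \<open>A single vertex is written \<open>{v, v}\<close>, so vertices and edges are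
    treated together and \<open>i = j\<close> stays possible below.\<close>
  have small: "\<exists>i j. {v. x v \<noteq> 0} = {i, j}" if "x \<in> U" for x
  proof -
    have "x \<in> topspace ?G" using that U(1) openin_subset by blast
    then have "{v. x v \<noteq> 0} \<in> simplices N E F" by (simp add: topspace_geometric_realization)
    moreover have "{v. x v \<noteq> 0} \<notin> F" using that not by blast
    ultimately consider v where "{v. x v \<noteq> 0} = {v}" | "{v. x v \<noteq> 0} \<in> E"
      unfolding simplices_def by blast
    then show ?thesis
    proof cases
      case 1
      then have "{v. x v \<noteq> 0} = {v, v}" by simp
      then show ?thesis by blast
    next
      case 2
      show ?thesis by (rule pair[OF 2])
    qed
  qed
  \<comment> \<open>A point of \<open>U\<close> with maximal support, so that the support is constant nearby.\<close>
  obtain x where x: "x \<in> U" and max: "\<And>y. y \<in> U \<Longrightarrow> card {v. y v \<noteq> 0} \<le> card {v. x v \<noteq> 0}"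
  proof -
    have "card {v. y v \<noteq> 0} < 3" if "y \<in> U" for y
    proof -
      obtain i j where ij: "{v. y v \<noteq> 0} = {i, j}" using small[OF \<open>y \<in> U\<close>] by (elim exE)
      show ?thesis unfolding ij by (cases "i = j") simp_all
    qed
    moreover obtain x0 where "x0 \<in> U" using U(2) by blast
    ultimately show ?thesis
      using ex_has_greatest_nat[of "\<lambda>x. x \<in> U" x0 "\<lambda>x. card {v. x v \<noteq> 0}" 3] that by blast
  qed
  obtain i j where ij: "{v. x v \<noteq> 0} = {i, j}" using small[OF x] by (elim exE)
  define U' where "U' = U \<inter> {y \<in> topspace ?G. y i \<noteq> 0} \<inter> {y \<in> topspace ?G. y j \<noteq> 0}"
  have oU': "openin ?G U'"
    unfolding U'_def by (intro openin_Int U openin_geometric_realization_support)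
  have "x \<in> U'"
  proof -
    have "x \<in> topspace ?G" using x U(1) openin_subset by blast
    moreover have "x i \<noteq> 0" "x j \<noteq> 0" using ij by blast+
    ultimately show ?thesis using x by (simp add: U'_def)
  qed
  have supp: "{v. y v \<noteq> 0} = {i, j}" if "y \<in> U'" for y
  proof -
    have yU: "y \<in> U" using that by (simp add: U'_def)
    obtain i' j' where "{v. y v \<noteq> 0} = {i', j'}" using small[OF yU] by (elim exE)
    then have "finite {v. y v \<noteq> 0}" by (metis finite.emptyI finite.insertI)
    moreover have "{i, j} \<subseteq> {v. y v \<noteq> 0}" using that by (simp add: U'_def)
    moreover have "card {v. y v \<noteq> 0} \<le> card {i, j}" using max[OF yU] unfolding ij .
    ultimately show ?thesis using card_seteq by blast
  qed
  have inj: "inj_on (\<lambda>y. y i) U'"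
  proof (rule inj_onI)
    fix y z assume y: "y \<in> U'" and z: "z \<in> U'" and eq: "y i = z i"
    have "(\<Sum>v\<in>{i, j}. w v) = 1" if "w \<in> U'" for w
      using that unfolding supp[OF that, symmetric] by (simp add: U'_def topspace_geometric_realization)
    from this[OF y] this[OF z]
    have "y j = z j" using eq by (cases "i = j") auto
    moreover have "y v = 0 \<and> z v = 0" if "v \<notin> {i, j}" for v
      using supp[OF y] supp[OF z] that by blast
    ultimately have "y v = z v" for v
      using eq by (cases "v = i"; cases "v = j") simp_all
    then show "y = z" by (rule ext)
  qed
  have coord: "continuous_map ?G euclideanreal (\<lambda>y. y i)"
    unfolding geometric_realization_def
    by (simp add: continuous_on_subset[OF continuous_on_product_coordinates])
  obtain h k where "homeomorphic_maps S ?G h k"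
    using T unfolding triangulates_def homeomorphic_space_def by blast
  then have h: "continuous_map S ?G h" and k: "continuous_map ?G S k"
    and kh: "\<And>p. p \<in> topspace S \<Longrightarrow> k (h p) = p" and hk: "\<And>y. y \<in> topspace ?G \<Longrightarrow> h (k y) = y"
    unfolding homeomorphic_maps_def by blast+
  let ?P = "{p \<in> topspace S. h p \<in> U'}"
  have "continuous_map (subtopology S ?P) euclideanreal ((\<lambda>y. y i) \<circ> h)"
    by (rule continuous_map_compose[OF continuous_map_from_subtopology[OF h] coord])
  moreover have "inj_on h ?P"
    by (rule inj_on_inverseI[of _ k]) (simp add: kh)
  then have "inj_on ((\<lambda>y. y i) \<circ> h) ?P"
    by (rule comp_inj_on) (rule inj_on_subset[OF inj], blast)
  moreover have "openin S ?P"
    by (rule openin_continuous_map_preimage[OF h oU'])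
  moreover have "x \<in> topspace ?G" using \<open>x \<in> U'\<close> by (simp add: U'_def)
  then have "k x \<in> ?P"
    using continuous_map_image_subset_topspace[OF k] hk[of x] \<open>x \<in> U'\<close> by auto
  ultimately show False
    using no_injection_from_surface_to_line[OF S] by blast
qed

lemma vertex_in_geometric_realization:
  assumes "v \<in> {1..N}"
  shows "(\<lambda>w. if w = v then 1 else 0) \<in> topspace (geometric_realization (simplices N E F))"
proof -
  have "{w. (if w = v then 1 else 0::real) \<noteq> 0} = {v}" by auto
  then show ?thesis
    using assms by (simp add: topspace_geometric_realization simplices_def)
qed

text \<open>The open star of \<open>v\<close> is nonempty, so it meets an open face, and the face
  then has \<open>v\<close> as a vertex.\<close>

lemma vertex_in_face:
  assumes "surface_without_boundary S" "triangulates S N E F" "v \<in> {1..N}"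
  obtains f where "f \<in> F" "v \<in> f"
proof -
  let ?G = "geometric_realization (simplices N E F)"
  have "{x \<in> topspace ?G. x v \<noteq> 0} \<noteq> {}"
  proof -
    have "(\<lambda>w. if w = v then 1 else 0) \<in> {x \<in> topspace ?G. x v \<noteq> 0}"
      using vertex_in_geometric_realization[OF assms(3), of E F] by simp
    then show ?thesis by blast
  qed
  then obtain x where "x \<in> {x \<in> topspace ?G. x v \<noteq> 0}" "{w. x w \<noteq> 0} \<in> F"
    using open_set_meets_face[OF assms(1,2) openin_geometric_realization_support] by blast
  then show ?thesis using that by blast
qed

text \<open>The open stars of \<open>M\<close> and those of its complement cover the realization. If
  the two unions met, their open intersection would meet an open face with vertices on both sides.
  Connectedness then rules out a nonempty complement.\<close>

lemma face_closed_set_eq_vertices: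
  assumes S: "surface_without_boundary S" "connected_space S" and T: "triangulates S N E F"
    and M: "M \<subseteq> {1..N}" "M \<noteq> {}" and closed: "\<And>f. \<lbrakk>f \<in> F; f \<inter> M \<noteq> {}\<rbrakk> \<Longrightarrow> f \<subseteq> M"
  shows "M = {1..N}"
proof (rule ccontr)
  assume "M \<noteq> {1..N}"
  let ?G = "geometric_realization (simplices N E F)"
  define X where "X P = (\<Union>v\<in>P. {x \<in> topspace ?G. x v \<noteq> 0})" for P
  have opn: "openin ?G (X P)" for P
    unfolding X_def by (intro openin_Union ballI) (auto simp: openin_geometric_realization_support)
  have ne: "X P \<noteq> {}" if P: "P \<subseteq> {1..N}" "P \<noteq> {}" for P
  proof -
    obtain v where v: "v \<in> P" using P by blast
    then have "(\<lambda>w. if w = v then 1 else 0) \<in> topspace ?G"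
      using vertex_in_geometric_realization P(1) by blast
    with v have "(\<lambda>w. if w = v then 1 else 0) \<in> X P"
      unfolding X_def by simp
    then show ?thesis by blast
  qed
  have "X M \<inter> X ({1..N} - M) = {}"
  proof (rule ccontr)
    assume "X M \<inter> X ({1..N} - M) \<noteq> {}"
    then obtain x where "x \<in> X M \<inter> X ({1..N} - M)" "{v. x v \<noteq> 0} \<in> F"
      using open_set_meets_face[OF S(1) T openin_Int[OF opn opn]] by blast
    then show False using closed[of "{v. x v \<noteq> 0}"] unfolding X_def by blast
  qed
  moreover have "topspace ?G \<subseteq> X M \<union> X ({1..N} - M)"
  proof
    fix x assume x: "x \<in> topspace ?G"
    then have "{v. x v \<noteq> 0} \<in> simplices N E F" by (simp add: topspace_geometric_realization)
    moreover have "A \<subseteq> {1..N}" if "A \<in> simplices N E F" for A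
      using T that by (auto simp: simplices_def triangulates_def simplicial_2_complex_def)
    ultimately have "{v. x v \<noteq> 0} \<subseteq> {1..N}" by blast
    moreover have "(\<Sum>v | x v \<noteq> 0. x v) = 1"
      using x by (simp add: topspace_geometric_realization)
    then have "{v. x v \<noteq> 0} \<noteq> {}" by (metis sum.empty zero_neq_one)
    ultimately show "x \<in> X M \<union> X ({1..N} - M)" using x unfolding X_def by blast
  qed
  moreover have "connected_space ?G"
    using S(2) T homeomorphic_connected_space by (auto simp: triangulates_def)
  ultimately show False
    using connected_spaceD[OF _ opn opn] ne[OF M] ne[of "{1..N} - M"] M \<open>M \<noteq> {1..N}\<close> by blast
qed

subsection \<open>Angles of circle packings\<close>

lemma edge_length_commute: "edge_length g I r i j = edge_length g I r j i"
  by (cases g) (simp_all add: insert_commute algebra_simps)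

text \<open>At \<open>c = -1\<close> the right-hand side would be \<open>cosh (p - q)\<close>, and
  it increases strictly with \<open>c\<close>.\<close>

lemma cosh_edge_gt_1:
  fixes p q c :: real
  assumes "0 < p" "0 < q" "-1 < c"
  shows "1 < cosh p * cosh q + c * sinh p * sinh q"
proof -
  have "1 \<le> cosh (p - q)" by (rule cosh_real_ge_1)
  also have "\<dots> = cosh p * cosh q - sinh p * sinh q" by (rule cosh_diff)
  also have "\<dots> < cosh p * cosh q + c * (sinh p * sinh q)"
    using assms mult_strict_right_mono[of "-1" c "sinh p * sinh q"] by simp
  finally show ?thesis by (simp add: mult.assoc)
qed

lemma edge_length_pos:
  assumes "0 < r i" "0 < r j" "-1 < I {i, j}"
  shows "0 < edge_length g I r i j"
proof (cases g)
  case Euclidean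
  have "0 < (r i - r j)\<^sup>2 + 2 * ((1 + I {i, j}) * (r i * r j))"
    using assms by (intro add_nonneg_pos) auto
  also have "\<dots> = (r i)\<^sup>2 + (r j)\<^sup>2 + 2 * r i * r j * I {i, j}" by algebra
  finally show ?thesis using Euclidean by simp
next
  case Hyperbolic
  then show ?thesis using cosh_edge_gt_1[OF assms] by simp
qed

text \<open>The homogeneous form, to be matched with the law of cosines: \<open>m\<close> and
  \<open>n\<close> become \<open>r i\<close> in the Euclidean case and the quantities
  \<open>\<kappa>\<close> in the hyperbolic one.\<close>

lemma wedge_cos_divide:
  assumes "0 < m" "0 < n"
  shows "wedge_cos a b c (p / m) (q / n)
    = (m * n + a * n * p + b * m * q - c * p * q)
      / (sqrt (m\<^sup>2 + p\<^sup>2 + 2 * a * m * p) * sqrt (n\<^sup>2 + q\<^sup>2 + 2 * b * n * q))"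
proof -
  have root: "sqrt (1 + (p / m)\<^sup>2 + 2 * a * (p / m)) = sqrt (m\<^sup>2 + p\<^sup>2 + 2 * a * m * p) / m"
    if "0 < m" for a m p :: real
  proof -
    have "1 + (p / m)\<^sup>2 + 2 * a * (p / m) = (m\<^sup>2 + p\<^sup>2 + 2 * a * m * p) / m\<^sup>2"
      using that by (simp add: field_simps power2_eq_square)
    then show ?thesis using that by (simp add: real_sqrt_divide)
  qed
  have "1 + a * (p / m) + b * (q / n) - c * (p / m) * (q / n)
      = (m * n + a * n * p + b * m * q - c * p * q) / (m * n)"
    using assms by (simp add: field_simps)
  then show ?thesis
    unfolding wedge_cos_def root[OF assms(1)] root[OF assms(2)] using assms by simp
qed

text \<open>Expressing the ratio by \<open>sinh\<close> and \<open>cosh\<close> of the full radii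
  makes the comparison with the hyperbolic law of cosines polynomial. The proof substitutes the
  half-argument formulas in \<open>a\<close> and \<open>b\<close>.\<close>

lemma relative_radius_hyperbolic:
  fixes p q c :: real
  assumes "0 < p" "0 < q" "-1 < c"
  defines "\<kappa> \<equiv> sinh p * cosh q + c * sinh q * (cosh p - 1)"
  shows "0 < \<kappa>" and "relative_radius Hyperbolic c (tanh (p / 2)) (tanh (q / 2)) = sinh q / \<kappa>"
proof -
  define a b where "a = tanh (p / 2)" and "b = tanh (q / 2)"
  have ab: "0 < a" "a < 1" "0 < b" "b < 1"
    using assms by (simp_all add: a_def b_def tanh_real_lt_1)
  then have sq: "0 < 1 - a\<^sup>2" "0 < 1 - b\<^sup>2" by (simp_all add: abs_square_less_1)
  have half: "cosh t = (1 + (tanh (t / 2))\<^sup>2) / (1 - (tanh (t / 2))\<^sup>2)"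
    "sinh t = 2 * tanh (t / 2) / (1 - (tanh (t / 2))\<^sup>2)" for t :: real
  proof -
    have "1 - (tanh (t / 2))\<^sup>2 = ((cosh (t / 2))\<^sup>2 - (sinh (t / 2))\<^sup>2) / (cosh (t / 2))\<^sup>2"
      by (simp add: tanh_def power_divide diff_divide_distrib)
    then have minus: "1 - (tanh (t / 2))\<^sup>2 = 1 / (cosh (t / 2))\<^sup>2"
      by (simp add: hyperbolic_pythagoras)
    have plus: "1 + (tanh (t / 2))\<^sup>2 = ((cosh (t / 2))\<^sup>2 + (sinh (t / 2))\<^sup>2) / (cosh (t / 2))\<^sup>2"
      by (simp add: tanh_def power_divide add_divide_distrib)
    show "cosh t = (1 + (tanh (t / 2))\<^sup>2) / (1 - (tanh (t / 2))\<^sup>2)"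
      using cosh_double[of "t / 2"] unfolding minus plus by simp
    show "sinh t = 2 * tanh (t / 2) / (1 - (tanh (t / 2))\<^sup>2)"
      using sinh_double[of "t / 2"] unfolding minus by (simp add: tanh_def power2_eq_square)
  qed
  have pq: "cosh p = (1 + a\<^sup>2) / (1 - a\<^sup>2)" "sinh p = 2 * a / (1 - a\<^sup>2)"
    "cosh q = (1 + b\<^sup>2) / (1 - b\<^sup>2)" "sinh q = 2 * b / (1 - b\<^sup>2)"
    unfolding a_def b_def by (rule half)+
  have Q: "0 < 1 + b\<^sup>2 + 2 * c * a * b" using ab assms by (intro inversive_denom_pos)
  have "cosh p - 1 = 2 * a\<^sup>2 / (1 - a\<^sup>2)" using sq by (simp add: pq field_simps)
  then have "\<kappa> = (2 * a * (1 + b\<^sup>2) + 2 * b * c * (2 * a\<^sup>2)) / ((1 - a\<^sup>2) * (1 - b\<^sup>2))"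
    unfolding \<kappa>_def by (simp add: pq(2-4) add_divide_distrib distrib_left mult_ac)
  also have "2 * a * (1 + b\<^sup>2) + 2 * b * c * (2 * a\<^sup>2) = 2 * a * (1 + b\<^sup>2 + 2 * c * a * b)"
    by algebra
  finally have \<kappa>: "\<kappa> = 2 * a * (1 + b\<^sup>2 + 2 * c * a * b) / ((1 - a\<^sup>2) * (1 - b\<^sup>2))" .
  show "0 < \<kappa>" unfolding \<kappa> using ab sq Q by simp
  have cancel: "(b / a) * (x / z) = (2 * b / y) / (2 * a * z / (x * y))"
    if "x \<noteq> 0" "y \<noteq> 0" for x y z
    using that by simp
  show "relative_radius Hyperbolic c (tanh (p / 2)) (tanh (q / 2)) = sinh q / \<kappa>"
    unfolding a_def[symmetric] b_def[symmetric] \<kappa> pq(4) relative_radius.simps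
    by (rule cancel) (use sq in auto)
qed

text \<open>Numerator and radicands are matched separately with \<open>wedge_cos_divide\<close>. In
  the hyperbolic case the matching identities follow from
  \<open>cosh\<^sup>2 - sinh\<^sup>2 = 1\<close>.\<close>

lemma law_of_cosines_edge_length:
  assumes pos: "0 < r i" "0 < r j" "0 < r k"
    and I: "-1 < I {i, j}" "-1 < I {i, k}" "-1 < I {j, k}"
  shows "law_of_cosines g (edge_length g I r i j) (edge_length g I r i k) (edge_length g I r j k)
    = wedge_cos (I {i, j}) (I {i, k}) (I {j, k})
        (relative_radius g (I {i, j}) (radius_scale g (r i)) (radius_scale g (r j)))
        (relative_radius g (I {i, k}) (radius_scale g (r i)) (radius_scale g (r k)))"
proof (cases g)
  case Euclidean
  have sq: "(edge_length Euclidean I r v w)\<^sup>2 = (r v)\<^sup>2 + (r w)\<^sup>2 + 2 * r v * r w * I {v, w}"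
    if "0 < edge_length Euclidean I r v w" for v w
    using that by simp
  have l: "0 < edge_length Euclidean I r i j" "0 < edge_length Euclidean I r i k"
    "0 < edge_length Euclidean I r j k"
    using pos I by (simp_all add: edge_length_pos del: edge_length.simps)
  have n: "(edge_length Euclidean I r i j)\<^sup>2 + (edge_length Euclidean I r i k)\<^sup>2 - (edge_length Euclidean I r j k)\<^sup>2
      = 2 * (r i * r i + I {i, j} * r i * r j + I {i, k} * r i * r k - I {j, k} * r j * r k)"
    unfolding sq[OF l(1)] sq[OF l(2)] sq[OF l(3)] by (simp add: power2_eq_square algebra_simps)
  have cancel: "2 * x / (2 * y * z) = x / (y * z)" for x y z :: real
    by (simp add: mult.assoc)
  show ?thesis
    unfolding Euclidean law_of_cosines.simps n cancel relative_radius.simps radius_scale.simps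
      wedge_cos_divide[OF pos(1) pos(1)]
    by (simp add: mult_ac)
next
  case Hyperbolic
  define X where "X v w = cosh (r v) * cosh (r w) + I {v, w} * sinh (r v) * sinh (r w)" for v w
  define \<kappa> where "\<kappa> w = sinh (r i) * cosh (r w) + I {i, w} * sinh (r w) * (cosh (r i) - 1)" for w
  have X: "1 < X i j" "1 < X i k" "1 < X j k"
    unfolding X_def using pos I by (intro cosh_edge_gt_1; simp)+
  have \<kappa>: "0 < \<kappa> j" "0 < \<kappa> k"
    unfolding \<kappa>_def using pos I by (intro relative_radius_hyperbolic(1); simp)+
  have cosh2: "(cosh t)\<^sup>2 = (sinh t)\<^sup>2 + 1" for t :: real by (rule cosh_square_eq)
  have sq: "(X i w)\<^sup>2 - 1 = (\<kappa> w)\<^sup>2 + (sinh (r w))\<^sup>2 + 2 * I {i, w} * \<kappa> w * sinh (r w)" for w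
    using cosh2[of "r i"] cosh2[of "r w"] unfolding X_def \<kappa>_def by algebra
  have n: "X i j * X i k - X j k
      = \<kappa> j * \<kappa> k + I {i, j} * \<kappa> k * sinh (r j) + I {i, k} * \<kappa> j * sinh (r k)
        - I {j, k} * sinh (r j) * sinh (r k)"
    using cosh2[of "r i"] unfolding X_def \<kappa>_def by algebra
  have l: "cosh (edge_length Hyperbolic I r v w) = X v w"
    "sinh (edge_length Hyperbolic I r v w) = sqrt ((X v w)\<^sup>2 - 1)" if "1 < X v w" for v w
    using that by (simp_all add: X_def sinh_arcosh_real)
  have rel: "relative_radius Hyperbolic (I {i, j}) (tanh (r i / 2)) (tanh (r j / 2)) = sinh (r j) / \<kappa> j"
    "relative_radius Hyperbolic (I {i, k}) (tanh (r i / 2)) (tanh (r k / 2)) = sinh (r k) / \<kappa> k"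
    unfolding \<kappa>_def using pos I by (intro relative_radius_hyperbolic(2); simp)+
  show ?thesis
    unfolding Hyperbolic law_of_cosines.simps radius_scale.simps rel wedge_cos_divide[OF \<kappa>]
      l[OF X(1)] l[OF X(2)] l[OF X(3)] n sq ..
qed

definition admissible_triple :: "(nat set \<Rightarrow> real) \<Rightarrow> nat \<Rightarrow> nat \<Rightarrow> nat \<Rightarrow> bool" where
  "admissible_triple I i j k \<longleftrightarrow> i \<noteq> j \<and> i \<noteq> k \<and> j \<noteq> k \<and>
     I {i, j} \<in> {-1<..1} \<and> I {i, k} \<in> {-1<..1} \<and> I {j, k} \<in> {-1<..1} \<and>
     0 \<le> I {j, k} + I {i, j} * I {i, k} \<and>
     0 \<le> I {i, k} + I {i, j} * I {j, k} \<and>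
     0 \<le> I {i, j} + I {i, k} * I {j, k}"

lemma
  fixes g :: geometry
  assumes adm: "admissible_triple I i j k" and pos: "0 < r i" "0 < r j" "0 < r k"
  defines "w \<equiv> wedge_cos (I {i, j}) (I {i, k}) (I {j, k})
      (relative_radius g (I {i, j}) (radius_scale g (r i)) (radius_scale g (r j)))
      (relative_radius g (I {i, k}) (radius_scale g (r i)) (radius_scale g (r k)))"
  shows abs_wedge_cos_triple_le_1: "\<bar>w\<bar> \<le> 1"
    and inner_angle_triple: "inner_angle g (edge_length g I r) {i, j, k} i = arccos w"
proof -
  have I: "-1 < I {i, j}" "-1 < I {i, k}" "-1 < I {j, k}"
    using adm by (auto simp: admissible_triple_def)
  have "0 < relative_radius g c (radius_scale g (r i)) (radius_scale g (r v))"
    if "-1 < c" "0 < r v" for c v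
    using that pos by (intro relative_radius_pos radius_scale_pos) (use radius_scale_less_1 in auto)
  then show bound: "\<bar>w\<bar> \<le> 1"
    unfolding w_def using adm pos I by (intro abs_wedge_cos_le_1) (auto simp: admissible_triple_def)
  have w: "w = law_of_cosines g (edge_length g I r i j) (edge_length g I r i k) (edge_length g I r j k)"
    unfolding w_def using law_of_cosines_edge_length[of r i j k I g] pos I by simp
  show "inner_angle g (edge_length g I r) {i, j, k} i = arccos w"
    unfolding w
    using adm pos I bound unfolding w admissible_triple_def
    by (intro inner_angle_eq edge_length_commute edge_length_pos) auto
qed

text \<open>Passing from \<open>R\<close> to \<open>r\<close>, the size at \<open>i\<close> grows by
  the factor \<open>s\<close> and its neighbours by no more, so their relative radii do not
  increase; hence the cosine does not decrease.\<close>

lemma inner_angle_compare: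
  assumes adm: "admissible_triple I i j k"
    and R: "0 < R i" "0 < R j" "0 < R k" and r: "0 < r i" "0 < r j" "0 < r k"
    and s: "1 < s" "radius_scale g (r i) = s * radius_scale g (R i)"
      "radius_scale g (r j) \<le> s * radius_scale g (R j)"
      "radius_scale g (r k) \<le> s * radius_scale g (R k)"
  shows "inner_angle g (edge_length g I r) {i, j, k} i \<le> inner_angle g (edge_length g I R) {i, j, k} i"
    and "\<lbrakk>\<not> (I {i, j} = 1 \<and> I {i, k} = - I {j, k});
          g = Hyperbolic \<or> radius_scale g (r j) \<noteq> s * radius_scale g (R j)\<rbrakk> \<Longrightarrow>
      inner_angle g (edge_length g I r) {i, j, k} i < inner_angle g (edge_length g I R) {i, j, k} i"
proof -
  let ?x = "\<lambda>r v. relative_radius g (I {i, v}) (radius_scale g (r i)) (radius_scale g (r v))"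
  have I: "-1 < I {i, j}" "I {i, j} \<le> 1" "-1 < I {i, k}" "I {i, k} \<le> 1"
    "0 \<le> I {j, k} + I {i, j} * I {i, k}" "0 \<le> I {i, k} + I {i, j} * I {j, k}"
    "0 \<le> I {i, j} + I {i, k} * I {j, k}"
    using adm by (auto simp: admissible_triple_def)
  have pos: "0 < ?x r v" if "-1 < I {i, v}" "0 < r v" for v
    using that r by (intro relative_radius_pos radius_scale_pos) (use radius_scale_less_1 in auto)
  have hyp: "g = Hyperbolic \<Longrightarrow> radius_scale g (R i) < 1 \<and> radius_scale g (R v) < 1 \<and>
      s * radius_scale g (R i) < 1 \<and> radius_scale g (r v) < 1" for v
    using radius_scale_less_1 s(2) by metis
  have le: "?x r v \<le> ?x R v"
    if "-1 < I {i, v}" "0 < R v" "0 < r v" "radius_scale g (r v) \<le> s * radius_scale g (R v)" for v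
    unfolding s(2) using that R s(1) hyp
    by (intro relative_radius_compare(1) radius_scale_pos) auto
  have less: "?x r j < ?x R j" if "g = Hyperbolic \<or> radius_scale g (r j) \<noteq> s * radius_scale g (R j)"
    unfolding s(2) using that R r s(1,3) hyp I
    by (intro relative_radius_compare(2) radius_scale_pos) auto
  note mono = wedge_cos_antimono2[OF I(1-4) pos[OF I(1) r(2)] le[OF I(1) R(2) r(2) s(3)]
      pos[OF I(3) r(3)] le[OF I(3) R(3) r(3) s(4)] I(5-7)]
  note bounds = abs_wedge_cos_triple_le_1[OF adm r] abs_wedge_cos_triple_le_1[OF adm R]
  show "inner_angle g (edge_length g I r) {i, j, k} i \<le> inner_angle g (edge_length g I R) {i, j, k} i"
    unfolding inner_angle_triple[OF adm r] inner_angle_triple[OF adm R]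
    using mono(1) bounds by (simp add: arccos_le_mono)
  assume "\<not> (I {i, j} = 1 \<and> I {i, k} = - I {j, k})"
    "g = Hyperbolic \<or> radius_scale g (r j) \<noteq> s * radius_scale g (R j)"
  then show "inner_angle g (edge_length g I r) {i, j, k} i < inner_angle g (edge_length g I R) {i, j, k} i"
    unfolding inner_angle_triple[OF adm r] inner_angle_triple[OF adm R]
    using mono(2) less bounds by (simp add: arccos_less_mono)
qed

section \<open>The maximum principle for the ratio of the two metrics\<close>

theorem theorem2p6p9:
  fixes S :: "'a topology" and N :: nat and E F :: "nat set set"
    and I :: "nat set \<Rightarrow> real" and g :: geometry
    and A B :: "nat set" and R r :: "nat \<Rightarrow> real"
  assumes "closed_surface S" and "connected_space S"
    and "triangulates S N E F"
    and "\<And>e. e \<in> E \<Longrightarrow> I e \<in> {-1<..1}"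
    and "{1..N} = A \<union> B" and "A \<inter> B = {}" and "A \<noteq> {}"
    and "g = Euclidean \<Longrightarrow> B \<noteq> {}"
    and "\<And>i j k. {i, j, k} \<in> F \<Longrightarrow>
           I {j, k} + I {i, k} * I {i, j} \<ge> 0 \<and>
           I {i, k} + I {j, k} * I {i, j} \<ge> 0 \<and>
           I {i, j} + I {j, k} * I {i, k} \<ge> 0"
    and "circle_packing_metric g N F I R" and "circle_packing_metric g N F I r"
    and "\<And>i. i \<in> B \<Longrightarrow> R i \<ge> r i"
    and "\<And>i. i \<in> A \<Longrightarrow> curvature g F I R i \<ge> curvature g F I r i"
  shows "\<forall>i\<in>{1..N}. R i \<ge> r i"
proof (rule ccontr)
  assume "\<not> (\<forall>i\<in>{1..N}. R i \<ge> r i)"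
  then obtain v0 where v0: "v0 \<in> {1..N}" "R v0 < r v0" by auto
  have S: "surface_without_boundary S" using assms(1) by (simp add: closed_surface_def)
  have pos: "0 < R v" "0 < r v" if "v \<in> {1..N}" for v
    using assms(10,11) that by (simp_all add: circle_packing_metric_def)
  have faces: "f \<subseteq> {1..N}" "card f = 3" if "f \<in> F" for f
    using assms(3) that by (simp_all add: triangulates_def simplicial_2_complex_def)
  then have "F \<subseteq> Pow {1..N}" by blast
  then have finF: "finite F" by (rule finite_subset) simp
  have adm: "admissible_triple I i j k" if "{i, j, k} \<in> F" "card {i, j, k} = 3" for i j k
  proof -
    have "i \<noteq> j" "i \<noteq> k" "j \<noteq> k" using that(2) by (auto simp: card_insert_if split: if_splits)
    moreover have "I e \<in> {-1<..1}" if "e \<subseteq> {i, j, k}" "card e = 2" for e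
      using assms(3,4) that \<open>{i, j, k} \<in> F\<close> by (simp add: triangulates_def simplicial_2_complex_def)
    ultimately have "I {i, j} \<in> {-1<..1}" "I {i, k} \<in> {-1<..1}" "I {j, k} \<in> {-1<..1}"
      by (metis card_2_iff insert_commute subset_insertI)+
    with \<open>i \<noteq> j\<close> \<open>i \<noteq> k\<close> \<open>j \<noteq> k\<close> assms(9)[OF that(1)] show ?thesis
      by (simp add: admissible_triple_def mult.commute)
  qed
  let ?t = "radius_scale g"
  define s where "s = Max ((\<lambda>v. ?t (r v) / ?t (R v)) ` {1..N})"
  have s_ge: "?t (r v) \<le> s * ?t (R v)" if "v \<in> {1..N}" for v
  proof -
    have "?t (r v) / ?t (R v) \<le> s" unfolding s_def using that by (intro Max_ge) auto
    then show ?thesis using radius_scale_pos[OF pos(1)[OF that], of g] by (simp add: divide_le_eq)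
  qed
  define M where "M = {v \<in> {1..N}. ?t (r v) = s * ?t (R v)}"
  have "s \<in> (\<lambda>v. ?t (r v) / ?t (R v)) ` {1..N}"
    unfolding s_def using v0 by (intro Max_in) auto
  then obtain m where m: "m \<in> {1..N}" "s = ?t (r m) / ?t (R m)" by blast
  then have "m \<in> M" using radius_scale_pos[OF pos(1)[OF m(1)], of g] by (simp add: M_def)
  have "1 < s"
  proof -
    have "?t (R v0) < ?t (r v0)" using v0(2) radius_scale_le_iff[of g "r v0" "R v0"] by linarith
    also have "\<dots> \<le> s * ?t (R v0)" using s_ge v0 by blast
    finally show ?thesis using radius_scale_pos[OF pos(1)[OF v0(1)], of g] by simp
  qed
  have "M \<inter> B = {}"
  proof (rule ccontr)
    assume "M \<inter> B \<noteq> {}"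
    then obtain v where v: "v \<in> {1..N}" "?t (r v) = s * ?t (R v)" "v \<in> B" by (auto simp: M_def)
    have "?t (r v) \<le> ?t (R v)" using assms(12)[OF v(3)] by (simp only: radius_scale_le_iff)
    then show False
      using v \<open>1 < s\<close> radius_scale_pos[OF pos(1)[OF v(1)], of g] by simp
  qed
  then have "M \<subseteq> A" using assms(5) unfolding M_def by blast
  let ?angle = "\<lambda>r f i. inner_angle g (edge_length g I r) f i"
  have compare: "?angle r {i, j, k} i \<le> ?angle R {i, j, k} i"
    "\<lbrakk>\<not> (I {i, j} = 1 \<and> I {i, k} = - I {j, k}); g = Hyperbolic \<or> j \<notin> M\<rbrakk> \<Longrightarrow>
      ?angle r {i, j, k} i < ?angle R {i, j, k} i"
    if "i \<in> M" "{i, j, k} \<in> F" for i j k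
  proof -
    have v: "i \<in> {1..N}" "j \<in> {1..N}" "k \<in> {1..N}" using faces(1)[OF that(2)] by auto
    have a: "admissible_triple I i j k" using adm[OF that(2) faces(2)[OF that(2)]] .
    have si: "?t (r i) = s * ?t (R i)" using \<open>i \<in> M\<close> by (simp add: M_def)
    note c = inner_angle_compare[OF a pos(1)[OF v(1)] pos(1)[OF v(2)] pos(1)[OF v(3)]
        pos(2)[OF v(1)] pos(2)[OF v(2)] pos(2)[OF v(3)] \<open>1 < s\<close> si s_ge[OF v(2)] s_ge[OF v(3)]]
    show "?angle r {i, j, k} i \<le> ?angle R {i, j, k} i" by (rule c(1))
    show "?angle r {i, j, k} i < ?angle R {i, j, k} i"
      if "\<not> (I {i, j} = 1 \<and> I {i, k} = - I {j, k})" "g = Hyperbolic \<or> j \<notin> M"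
      by (rule c(2)) (use that v in \<open>auto simp: M_def\<close>)
  qed
  have triple: "\<exists>j k. f = {i, j, k}" if f: "f \<in> F" "i \<in> f" for f i
  proof -
    have "card (f - {i}) = 2" using faces[OF f(1)] f(2) by (simp add: card_Diff_singleton)
    then obtain j k where "f - {i} = {j, k}" by (auto simp: card_2_iff)
    then have "f = {i, j, k}" using f(2) by blast
    then show ?thesis by blast
  qed
  \<comment> \<open>Each angle for \<open>r\<close> is at most the one for \<open>R\<close>, whereas
    the curvature inequality orders the two sums the other way. So no term can be strictly
    smaller.\<close>
  have equal: "?angle r f i = ?angle R f i" if i: "i \<in> M" and f: "f \<in> F" "i \<in> f" for f i
  proof (rule ccontr)
    assume ne: "?angle r f i \<noteq> ?angle R f i"
    have le: "?angle r f' i \<le> ?angle R f' i" if "f' \<in> F" "i \<in> f'" for f'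
      using triple[OF that] compare(1)[OF i] that by blast
    then have "(\<Sum>f | f \<in> F \<and> i \<in> f. ?angle r f i) < (\<Sum>f | f \<in> F \<and> i \<in> f. ?angle R f i)"
      using finF f ne by (intro sum_strict_mono_ex1) (auto simp: less_le)
    moreover have "curvature g F I r i \<le> curvature g F I R i"
      using assms(13) i \<open>M \<subseteq> A\<close> by blast
    ultimately show False by (simp add: curvature_def)
  qed
  have spread: "g = Euclidean \<and> j \<in> M"
    if "i \<in> M" "{i, j, k} \<in> F" "\<not> (I {i, j} = 1 \<and> I {i, k} = - I {j, k})" for i j k
    using compare(2)[OF that] equal[OF that(1,2)] by (cases g) auto
  \<comment> \<open>If the angle at \<open>i\<close> does not depend on the radius at \<open>j\<close>, then \<open>j\<close> is reached through \<open>k\<close>.\<close>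
  have closed: "g = Euclidean \<and> j \<in> M" if i: "i \<in> M" and f: "{i, j, k} \<in> F" for i j k
  proof (cases "I {i, j} = 1 \<and> I {i, k} = - I {j, k}")
    case True
    have a: "admissible_triple I i j k" using adm[OF f faces(2)[OF f]] .
    \<comment> \<open>Since \<open>I {i, j} = 1\<close>, degeneracy of either of the two triples
      tried here would force an inversive distance of -1.\<close>
    then have "\<not> (I {i, k} = 1 \<and> I {i, j} = - I {k, j})"
      using True by (auto simp: admissible_triple_def insert_commute)
    then have "k \<in> M" using spread[of i k j] i f by (simp add: insert_commute)
    moreover have "\<not> (I {k, j} = 1 \<and> I {k, i} = - I {j, i})"
      using True a by (auto simp: admissible_triple_def insert_commute)
    ultimately show ?thesis using spread[of k j i] f by (simp add: insert_commute)
  qed (use spread i f in blast)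
  \<comment> \<open>A single face at \<open>m\<close> already rules out hyperbolic geometry; the
    rest spreads \<open>M\<close> over all faces.\<close>
  obtain f where f: "f \<in> F" "m \<in> f"
    using vertex_in_face[OF S assms(3) m(1)] by blast
  then have "g = Euclidean" using triple[OF f] closed[OF \<open>m \<in> M\<close>] by blast
  have "M = {1..N}"
  proof (rule face_closed_set_eq_vertices[OF S assms(2,3)])
    show "M \<subseteq> {1..N}" "M \<noteq> {}" using \<open>m \<in> M\<close> by (auto simp: M_def)
    fix f assume f: "f \<in> F" "f \<inter> M \<noteq> {}"
    then obtain i where i: "i \<in> M" "i \<in> f" by blast
    then obtain j k where jk: "f = {i, j, k}" using triple[OF f(1)] by blast
    then have "j \<in> M" "k \<in> M" using closed[of i j k] closed[of i k j] i f by (simp_all add: insert_commute)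
    then show "f \<subseteq> M" using jk i by simp
  qed
  then show False
    using \<open>M \<inter> B = {}\<close> assms(5) assms(8)[OF \<open>g = Euclidean\<close>] by blast
qed

end
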